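(* Let $\mathbf P=(P,\leq,{}',0,1)$ be a complemented poset and let $\mathbf L=(P,\sqcup,\sqcap,{}',0,1)$ be a $\lambda$-lattice assigned to $\mathbf P$. Then $\mathbf P$ is orthogonal if and only if $\mathbf L$ satisfies the identity $$(((x\sqcap y')\sqcup z)\sqcup(y\sqcup z))\sqcap((x\sqcap y')\sqcup y)\approx(x\sqcap y')\sqcup y .$$ Hence $\mathcal{L}o$, the class of all bounded $\lambda$-lattices $\mathbf L$ with a unary operation whose induced poset $\mathbb P(\mathbf L)$ is orthogonal, is a variety.
   Context: A bounded poset with a unary operation is a structure $\mathbf P=(P,\leq,{}',0,1)$ where $(P,\leq)$ is a poset with least element $0$ and greatest element $1$ and ${}'$ is an arbitrary unary operation on $P$. For $a,b\in P$, $a\vee b$ denotes $\sup(a,b)$ and $a\wedge b$ denotes $\inf(a,b)$, whenever these exist; $U(a,b)=\{x\in P\mid a,b\leq x\}$ and $L(a,b)=\{x\in P\mid x\leq a,b\}$. $\mathbf P$ is complemented if for every $x\in P$ the elements $x\vee x'$ and $x\wedge x'$ exist with $x\vee x'=1$ and $x\wedge x'=0$. A complemented poset is orthogonal if $x\vee y$ exists for all $x,y\in P$ with $x\leq y'$. A bounded $\lambda$-lattice is an algebra $(L,\sqcup,\sqcap,0,1)$ of type $(2,2,0,0)$ satisfying the identities $x\sqcup y\approx y\sqcup x$, $x\sqcap y\approx y\sqcap x$, $x\sqcup((x\sqcup y)\sqcup z)\approx(x\sqcup y)\sqcup z$, $x\sqcap((x\sqcap y)\sqcap z)\approx(x\sqcap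 y)\sqcap z$, $x\sqcup(x\sqcap y)\approx x$, $x\sqcap(x\sqcup y)\approx x$, $x\sqcup0\approx x$, $x\sqcup1\approx1$. A bounded $\lambda$-lattice with a unary operation is an algebra $\mathbf L=(L,\sqcup,\sqcap,{}',0,1)$ such that $(L,\sqcup,\sqcap,0,1)$ is a bounded $\lambda$-lattice and ${}'$ is a unary operation on $L$. Its induced bounded poset with a unary operation is $\mathbb P(\mathbf L)=(L,\leq,{}',0,1)$, where $x\leq y$ if and only if $x\sqcup y=y$. A $\lambda$-lattice assigned to a bounded poset $\mathbf P=(P,\leq,{}',0,1)$ with a unary operation is any algebra $(P,\sqcup,\sqcap,{}',0,1)$ (with the same ${}',0,1$) such that for all $x,y\in P$: if $x\vee y$ exists then $x\sqcup y=x\vee y$, otherwise $x\sqcup y=y\sqcup x$ is an arbitrarily chosen element of $U(x,y)$; if $x\wedge y$ exists then $x\sqcap y=x\wedge y$, otherwise $x\sqcap y=y\sqcap x$ is an arbitrarily chosen element of $L(x,y)$. It is a bounded $\lambda$-lattice with a unary operation.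
   Formalization: As stated, the class Lo is not closed under subalgebras, hence not a variety. Here Lo also requires that x ⊔ y equals the supremum x ∨ y in the induced poset whenever x ≤ y'; a variety means a class closed under homomorphic images, subalgebras and direct products. *)

theory Defs
  imports "HOL-Algebra.Order"
begin

record 'a unary_poset = "'a gorder" +
  pcompl :: "'a \<Rightarrow> 'a" (\<open>\<sim>\<index>_\<close> [81] 80)
  pzero :: 'a (\<open>\<zero>\<index>\<close>)
  pone :: 'a (\<open>\<one>\<index>\<close>)

locale bounded_unary_poset = partial_order P for P (structure) +
  assumes pcompl_closed: "x \<in> carrier P \<Longrightarrow> \<sim>x \<in> carrier P"
    and pzero_least: "least P \<zero> (carrier P)"
    and pone_greatest: "greatest P \<one> (carrier P)"

locale complemented_poset = bounded_unary_poset +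
  assumes compl_join: "x \<in> carrier P \<Longrightarrow> is_lub P \<one> {x, \<sim>x}"
    and compl_meet: "x \<in> carrier P \<Longrightarrow> is_glb P \<zero> {x, \<sim>x}"

locale orthogonal_poset = complemented_poset +
  assumes orth_join_exists:
    "\<lbrakk>x \<in> carrier P; y \<in> carrier P; x \<sqsubseteq> \<sim>y\<rbrakk> \<Longrightarrow> \<exists>s. is_lub P s {x, y}"

record 'a unary_lambda = "'a partial_object" +
  ljoin :: "'a \<Rightarrow> 'a \<Rightarrow> 'a" (infixl \<open>\<squnion>\<index>\<close> 65)
  lmeet :: "'a \<Rightarrow> 'a \<Rightarrow> 'a" (infixl \<open>\<sqinter>\<index>\<close> 70)
  lcompl :: "'a \<Rightarrow> 'a" (\<open>\<ominus>\<index>_\<close> [81] 80)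
  lbot :: 'a (\<open>\<bottom>\<^sub>\<lambda>\<index>\<close>)
  ltop :: 'a (\<open>\<top>\<^sub>\<lambda>\<index>\<close>)

locale bounded_unary_lambda_lattice =
  fixes L (structure)
  assumes join_closed: "\<lbrakk>x \<in> carrier L; y \<in> carrier L\<rbrakk> \<Longrightarrow> x \<squnion> y \<in> carrier L"
    and meet_closed: "\<lbrakk>x \<in> carrier L; y \<in> carrier L\<rbrakk> \<Longrightarrow> x \<sqinter> y \<in> carrier L"
    and compl_closed: "x \<in> carrier L \<Longrightarrow> \<ominus>x \<in> carrier L"
    and bot_closed: "\<bottom>\<^sub>\<lambda> \<in> carrier L"
    and top_closed: "\<top>\<^sub>\<lambda> \<in> carrier L"
    and join_comm: "\<lbrakk>x \<in> carrier L; y \<in> carrier L\<rbrakk> \<Longrightarrow> x \<squnion> y = y \<squnion> x"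
    and meet_comm: "\<lbrakk>x \<in> carrier L; y \<in> carrier L\<rbrakk> \<Longrightarrow> x \<sqinter> y = y \<sqinter> x"
    and join_weak_assoc: "\<lbrakk>x \<in> carrier L; y \<in> carrier L; z \<in> carrier L\<rbrakk>
      \<Longrightarrow> x \<squnion> ((x \<squnion> y) \<squnion> z) = (x \<squnion> y) \<squnion> z"
    and meet_weak_assoc: "\<lbrakk>x \<in> carrier L; y \<in> carrier L; z \<in> carrier L\<rbrakk>
      \<Longrightarrow> x \<sqinter> ((x \<sqinter> y) \<sqinter> z) = (x \<sqinter> y) \<sqinter> z"
    and join_absorb: "\<lbrakk>x \<in> carrier L; y \<in> carrier L\<rbrakk> \<Longrightarrow> x \<squnion> (x \<sqinter> y) = x"
    and meet_absorb: "\<lbrakk>x \<in> carrier L; y \<in> carrier L\<rbrakk> \<Longrightarrow> x \<sqinter> (x \<squnion> y) = x"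
    and join_bot: "x \<in> carrier L \<Longrightarrow> x \<squnion> \<bottom>\<^sub>\<lambda> = x"
    and join_top: "x \<in> carrier L \<Longrightarrow> x \<squnion> \<top>\<^sub>\<lambda> = \<top>\<^sub>\<lambda>"

definition induced_poset :: "'a unary_lambda \<Rightarrow> 'a unary_poset" where
  "induced_poset L = \<lparr>carrier = carrier L, eq = (=), le = (\<lambda>x y. x \<squnion>\<^bsub>L\<^esub> y = y),
     pcompl = lcompl L, pzero = lbot L, pone = ltop L\<rparr>"

definition assigned_lambda_lattice :: "'a unary_poset \<Rightarrow> 'a unary_lambda \<Rightarrow> bool" where
  "assigned_lambda_lattice P L \<longleftrightarrow>
     carrier L = carrier P \<and>
     (\<forall>x\<in>carrier P. \<ominus>\<^bsub>L\<^esub>x = \<sim>\<^bsub>P\<^esub>x) \<and> \<bottom>\<^sub>\<lambda>\<^bsub>L\<^esub> = \<zero>\<^bsub>P\<^esub> \<and> \<top>\<^sub>\<lambda>\<^bsub>L\<^esub> = \<one>\<^bsub>P\<^esub> \<and>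
     (\<forall>x\<in>carrier P. \<forall>y\<in>carrier P.
        (\<forall>s. is_lub P s {x, y} \<longrightarrow> x \<squnion>\<^bsub>L\<^esub> y = s) \<and>
        ((\<nexists>s. is_lub P s {x, y}) \<longrightarrow>
           x \<squnion>\<^bsub>L\<^esub> y = y \<squnion>\<^bsub>L\<^esub> x \<and> x \<squnion>\<^bsub>L\<^esub> y \<in> Upper P {x, y}) \<and>
        (\<forall>i. is_glb P i {x, y} \<longrightarrow> x \<sqinter>\<^bsub>L\<^esub> y = i) \<and>
        ((\<nexists>i. is_glb P i {x, y}) \<longrightarrow>
           x \<sqinter>\<^bsub>L\<^esub> y = y \<sqinter>\<^bsub>L\<^esub> x \<and> x \<sqinter>\<^bsub>L\<^esub> y \<in> Lower P {x, y}))"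

text \<open>
  In an arbitrary bounded lambda-lattice the operation \<open>\<squnion>\<close> need not return the join of
  two elements in the induced poset, even if that join exists. The last conjunct below asks for
  this agreement (which every assigned lambda-lattice has for all pairs, see
  \<open>assigned_in_Lo_iff\<close>) on exactly those pairs whose join must exist by orthogonality.
  It cannot be dropped: on the subsets of a four-element set let \<open>\<ominus>\<close> be set complement
  and let \<open>\<squnion>\<close>, \<open>\<sqinter>\<close> be union and intersection, except that two distinct singletons get the join \<open>\<top>\<^sub>\<lambda>\<close> and two
  distinct three-element sets the meet \<open>\<bottom>\<^sub>\<lambda>\<close>. The induced poset is the Boolean algebra,
  hence orthogonal, but the sets of size other than two form a subalgebra whose induced poset is
  not orthogonal. Nor does agreement on all pairs give a class closed under subalgebras, because
  a subalgebra may contain only one of several minimal upper bounds.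
\<close>

definition Lo :: "'a unary_lambda set" where
  "Lo = {L. bounded_unary_lambda_lattice L \<and> orthogonal_poset (induced_poset L) \<and>
     (\<forall>x\<in>carrier L. \<forall>y\<in>carrier L. \<forall>s.
        x \<sqsubseteq>\<^bsub>induced_poset L\<^esub> \<ominus>\<^bsub>L\<^esub>y \<and> is_lub (induced_poset L) s {x, y} \<longrightarrow> x \<squnion>\<^bsub>L\<^esub> y = s)}"

lemma assigned_in_Lo_iff:
  assumes "bounded_unary_lambda_lattice L" and "assigned_lambda_lattice (induced_poset L) L"
  shows "L \<in> Lo \<longleftrightarrow> orthogonal_poset (induced_poset L)"
  using assms unfolding Lo_def assigned_lambda_lattice_def
  by (auto simp: induced_poset_def)

definition lambda_hom :: "'a unary_lambda \<Rightarrow> 'b unary_lambda \<Rightarrow> ('a \<Rightarrow> 'b) set" where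
  "lambda_hom A B = {h \<in> carrier A \<rightarrow> carrier B.
     (\<forall>x\<in>carrier A. \<forall>y\<in>carrier A.
        h (x \<squnion>\<^bsub>A\<^esub> y) = h x \<squnion>\<^bsub>B\<^esub> h y \<and> h (x \<sqinter>\<^bsub>A\<^esub> y) = h x \<sqinter>\<^bsub>B\<^esub> h y) \<and>
     (\<forall>x\<in>carrier A. h (\<ominus>\<^bsub>A\<^esub>x) = \<ominus>\<^bsub>B\<^esub>(h x)) \<and>
     h \<bottom>\<^sub>\<lambda>\<^bsub>A\<^esub> = \<bottom>\<^sub>\<lambda>\<^bsub>B\<^esub> \<and> h \<top>\<^sub>\<lambda>\<^bsub>A\<^esub> = \<top>\<^sub>\<lambda>\<^bsub>B\<^esub>}"

definition subuniverse :: "'a set \<Rightarrow> 'a unary_lambda \<Rightarrow> bool" where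
  "subuniverse S A \<longleftrightarrow> S \<subseteq> carrier A \<and> \<bottom>\<^sub>\<lambda>\<^bsub>A\<^esub> \<in> S \<and> \<top>\<^sub>\<lambda>\<^bsub>A\<^esub> \<in> S \<and>
     (\<forall>x\<in>S. \<ominus>\<^bsub>A\<^esub>x \<in> S) \<and> (\<forall>x\<in>S. \<forall>y\<in>S. x \<squnion>\<^bsub>A\<^esub> y \<in> S \<and> x \<sqinter>\<^bsub>A\<^esub> y \<in> S)"

definition lambda_product :: "'i set \<Rightarrow> ('i \<Rightarrow> 'a unary_lambda) \<Rightarrow> ('i \<Rightarrow> 'a) unary_lambda" where
  "lambda_product I A = \<lparr>carrier = (\<Pi>\<^sub>E i\<in>I. carrier (A i)),
     ljoin = (\<lambda>f g. \<lambda>i\<in>I. f i \<squnion>\<^bsub>A i\<^esub> g i),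
     lmeet = (\<lambda>f g. \<lambda>i\<in>I. f i \<sqinter>\<^bsub>A i\<^esub> g i),
     lcompl = (\<lambda>f. \<lambda>i\<in>I. \<ominus>\<^bsub>A i\<^esub>(f i)),
     lbot = (\<lambda>i\<in>I. \<bottom>\<^sub>\<lambda>\<^bsub>A i\<^esub>),
     ltop = (\<lambda>i\<in>I. \<top>\<^sub>\<lambda>\<^bsub>A i\<^esub>)\<rparr>"

text \<open>
  A variety is a class closed under homomorphic images, subalgebras and direct products. A
  polymorphic class of algebras enters the definition through its instances at the type of the
  given algebras, of the homomorphic images, and of the direct products; with these types left
  as type variables, closure is asserted for algebras over all types.
\<close>

definition variety ::
  "'a unary_lambda set \<Rightarrow> 'b unary_lambda set \<Rightarrow> ('i \<Rightarrow> 'a) unary_lambda set \<Rightarrow> bool" where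
  "variety K K_img K_prod \<longleftrightarrow>
     (\<forall>A\<in>K. \<forall>B. \<forall>h\<in>lambda_hom A B. h ` carrier A = carrier B \<longrightarrow> B \<in> K_img) \<and>
     (\<forall>A\<in>K. \<forall>S. subuniverse S A \<longrightarrow> A\<lparr>carrier := S\<rparr> \<in> K) \<and>
     (\<forall>I A. (\<forall>i\<in>I. A i \<in> K) \<longrightarrow> lambda_product I A \<in> K_prod)"

end

theory Submission
  imports Defs
begin

text \<open>
  In a \<open>\<lambda>\<close>-lattice, an identity of the form \<open>s(x, y) \<le> (x \<squnion> z) \<squnion> (y \<squnion> z)\<close> says that \<open>s(x, y)\<close> lies
  below every common upper bound \<open>w\<close> of \<open>x\<close> and \<open>y\<close>: put \<open>z = w\<close> in one direction, and use that the
  right-hand side is itself a common upper bound in the other. So suprema, which \<open>\<squnion>\<close> need not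
  compute, become expressible by identities. Applied to \<open>x \<sqinter> \<ominus>y\<close> (an arbitrary element below
  \<open>\<ominus>y\<close>) and \<open>y\<close> this yields the identity of the theorem; applied to \<open>x\<close> and \<open>\<ominus>x\<close>, together with its
  dual, it expresses complementation. Hence \<open>Lo\<close> is an equational class.
\<close>

section \<open>Suprema and identities\<close>

definition orth_identity :: "('a, 'm) unary_lambda_scheme \<Rightarrow> bool" where
  "orth_identity L \<longleftrightarrow> (\<forall>x\<in>carrier L. \<forall>y\<in>carrier L. \<forall>z\<in>carrier L.
     (((x \<sqinter>\<^bsub>L\<^esub> \<ominus>\<^bsub>L\<^esub>y) \<squnion>\<^bsub>L\<^esub> z) \<squnion>\<^bsub>L\<^esub> (y \<squnion>\<^bsub>L\<^esub> z)) \<sqinter>\<^bsub>L\<^esub> ((x \<sqinter>\<^bsub>L\<^esub> \<ominus>\<^bsub>L\<^esub>y) \<squnion>\<^bsub>L\<^esub> y)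
       = (x \<sqinter>\<^bsub>L\<^esub> \<ominus>\<^bsub>L\<^esub>y) \<squnion>\<^bsub>L\<^esub> y)"

definition compl_identities :: "('a, 'm) unary_lambda_scheme \<Rightarrow> bool" where
  "compl_identities L \<longleftrightarrow> (\<forall>x\<in>carrier L. \<forall>z\<in>carrier L.
     (x \<squnion>\<^bsub>L\<^esub> z) \<squnion>\<^bsub>L\<^esub> (\<ominus>\<^bsub>L\<^esub>x \<squnion>\<^bsub>L\<^esub> z) = \<top>\<^sub>\<lambda>\<^bsub>L\<^esub> \<and>
     (x \<sqinter>\<^bsub>L\<^esub> z) \<sqinter>\<^bsub>L\<^esub> (\<ominus>\<^bsub>L\<^esub>x \<sqinter>\<^bsub>L\<^esub> z) = \<bottom>\<^sub>\<lambda>\<^bsub>L\<^esub>)"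

lemma (in partial_order) is_lub_pair_iff:
  assumes "x \<in> carrier L" "y \<in> carrier L"
  shows "is_lub L s {x, y} \<longleftrightarrow>
    s \<in> carrier L \<and> x \<sqsubseteq> s \<and> y \<sqsubseteq> s \<and> (\<forall>w\<in>carrier L. x \<sqsubseteq> w \<and> y \<sqsubseteq> w \<longrightarrow> s \<sqsubseteq> w)"
  using assms unfolding least_def Upper_def by auto

lemma (in partial_order) is_glb_pair_iff:
  assumes "x \<in> carrier L" "y \<in> carrier L"
  shows "is_glb L s {x, y} \<longleftrightarrow>
    s \<in> carrier L \<and> s \<sqsubseteq> x \<and> s \<sqsubseteq> y \<and> (\<forall>w\<in>carrier L. w \<sqsubseteq> x \<and> w \<sqsubseteq> y \<longrightarrow> w \<sqsubseteq> s)"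
  using assms unfolding greatest_def Lower_def by auto

text \<open>A common interface for assigned lambda-lattices and for lambda-lattices with their
  induced posets. The operations need only return bounds, and the right values on comparable pairs;
  nothing ties them to existing suprema of incomparable elements.\<close>

locale compatible_lambda = bounded_unary_poset P for P (structure) and L +
  assumes carrier_eq: "carrier L = carrier P"
    and compl_eq: "x \<in> carrier P \<Longrightarrow> \<ominus>\<^bsub>L\<^esub>x = \<sim>x"
    and bot_eq: "\<bottom>\<^sub>\<lambda>\<^bsub>L\<^esub> = \<zero>"
    and top_eq: "\<top>\<^sub>\<lambda>\<^bsub>L\<^esub> = \<one>"
    and join_Upper: "\<lbrakk>x \<in> carrier P; y \<in> carrier P\<rbrakk> \<Longrightarrow> x \<squnion>\<^bsub>L\<^esub> y \<in> Upper P {x, y}"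
    and meet_Lower: "\<lbrakk>x \<in> carrier P; y \<in> carrier P\<rbrakk> \<Longrightarrow> x \<sqinter>\<^bsub>L\<^esub> y \<in> Lower P {x, y}"
    and join_of_le: "\<lbrakk>x \<in> carrier P; y \<in> carrier P; x \<sqsubseteq> y\<rbrakk> \<Longrightarrow> x \<squnion>\<^bsub>L\<^esub> y = y"
    and meet_of_le: "\<lbrakk>x \<in> carrier P; y \<in> carrier P; x \<sqsubseteq> y\<rbrakk> \<Longrightarrow> x \<sqinter>\<^bsub>L\<^esub> y = x"
    and meet_of_ge: "\<lbrakk>x \<in> carrier P; y \<in> carrier P; y \<sqsubseteq> x\<rbrakk> \<Longrightarrow> x \<sqinter>\<^bsub>L\<^esub> y = y"
begin

lemma join_closed [simp]: "\<lbrakk>x \<in> carrier P; y \<in> carrier P\<rbrakk> \<Longrightarrow> x \<squnion>\<^bsub>L\<^esub> y \<in> carrier P"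
  and join_ge1: "\<lbrakk>x \<in> carrier P; y \<in> carrier P\<rbrakk> \<Longrightarrow> x \<sqsubseteq> x \<squnion>\<^bsub>L\<^esub> y"
  and join_ge2: "\<lbrakk>x \<in> carrier P; y \<in> carrier P\<rbrakk> \<Longrightarrow> y \<sqsubseteq> x \<squnion>\<^bsub>L\<^esub> y"
  using join_Upper[of x y] unfolding Upper_def by blast+

lemma meet_closed [simp]: "\<lbrakk>x \<in> carrier P; y \<in> carrier P\<rbrakk> \<Longrightarrow> x \<sqinter>\<^bsub>L\<^esub> y \<in> carrier P"
  and meet_le1: "\<lbrakk>x \<in> carrier P; y \<in> carrier P\<rbrakk> \<Longrightarrow> x \<sqinter>\<^bsub>L\<^esub> y \<sqsubseteq> x"
  and meet_le2: "\<lbrakk>x \<in> carrier P; y \<in> carrier P\<rbrakk> \<Longrightarrow> x \<sqinter>\<^bsub>L\<^esub> y \<sqsubseteq> y"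
  using meet_Lower[of x y] unfolding Lower_def by blast+

lemma meet_eq_right_iff:
  "\<lbrakk>x \<in> carrier P; y \<in> carrier P\<rbrakk> \<Longrightarrow> x \<sqinter>\<^bsub>L\<^esub> y = y \<longleftrightarrow> y \<sqsubseteq> x"
  using meet_le1[of x y] meet_of_ge[of x y] by auto

text \<open>Here \<open>s\<close> is arbitrary. Both applications take a known upper bound for it,
  \<open>(x \<sqinter> \<sim>y) \<squnion> y\<close> or \<open>\<one>\<close>, so that the
  right-hand side supplies the missing half of \<open>is_lub_pair_iff\<close>.\<close>

lemma le_joins_iff:
  assumes "x \<in> carrier P" "y \<in> carrier P" "s \<in> carrier P"
  shows "(\<forall>z\<in>carrier P. s \<sqsubseteq> (x \<squnion>\<^bsub>L\<^esub> z) \<squnion>\<^bsub>L\<^esub> (y \<squnion>\<^bsub>L\<^esub> z)) \<longleftrightarrow>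
    (\<forall>w\<in>carrier P. x \<sqsubseteq> w \<and> y \<sqsubseteq> w \<longrightarrow> s \<sqsubseteq> w)" (is "?L = ?R")
proof
  assume L: ?L
  show ?R
  proof (intro ballI impI)
    fix w assume w: "w \<in> carrier P" and "x \<sqsubseteq> w \<and> y \<sqsubseteq> w"
    then have "(x \<squnion>\<^bsub>L\<^esub> w) \<squnion>\<^bsub>L\<^esub> (y \<squnion>\<^bsub>L\<^esub> w) = w" using assms by (simp add: join_of_le)
    then show "s \<sqsubseteq> w" using L w by metis
  qed
next
  assume R: ?R
  show ?L
  proof
    fix z assume z: "z \<in> carrier P"
    have "x \<sqsubseteq> (x \<squnion>\<^bsub>L\<^esub> z) \<squnion>\<^bsub>L\<^esub> (y \<squnion>\<^bsub>L\<^esub> z)"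
      by (rule le_trans[of _ "x \<squnion>\<^bsub>L\<^esub> z"]) (use assms z in \<open>simp_all add: join_ge1\<close>)
    moreover have "y \<sqsubseteq> (x \<squnion>\<^bsub>L\<^esub> z) \<squnion>\<^bsub>L\<^esub> (y \<squnion>\<^bsub>L\<^esub> z)"
      by (rule le_trans[of _ "y \<squnion>\<^bsub>L\<^esub> z"]) (use assms z in \<open>simp_all add: join_ge1 join_ge2\<close>)
    ultimately show "s \<sqsubseteq> (x \<squnion>\<^bsub>L\<^esub> z) \<squnion>\<^bsub>L\<^esub> (y \<squnion>\<^bsub>L\<^esub> z)" using R assms z by simp
  qed
qed

lemma meets_le_iff:
  assumes "x \<in> carrier P" "y \<in> carrier P" "s \<in> carrier P"
  shows "(\<forall>z\<in>carrier P. (x \<sqinter>\<^bsub>L\<^esub> z) \<sqinter>\<^bsub>L\<^esub> (y \<sqinter>\<^bsub>L\<^esub> z) \<sqsubseteq> s) \<longleftrightarrow>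
    (\<forall>w\<in>carrier P. w \<sqsubseteq> x \<and> w \<sqsubseteq> y \<longrightarrow> w \<sqsubseteq> s)" (is "?L = ?R")
proof
  assume L: ?L
  show ?R
  proof (intro ballI impI)
    fix w assume w: "w \<in> carrier P" and "w \<sqsubseteq> x \<and> w \<sqsubseteq> y"
    then have "(x \<sqinter>\<^bsub>L\<^esub> w) \<sqinter>\<^bsub>L\<^esub> (y \<sqinter>\<^bsub>L\<^esub> w) = w" using assms by (simp add: meet_of_ge)
    then show "w \<sqsubseteq> s" using L w by metis
  qed
next
  assume R: ?R
  show ?L
  proof
    fix z assume z: "z \<in> carrier P"
    have "(x \<sqinter>\<^bsub>L\<^esub> z) \<sqinter>\<^bsub>L\<^esub> (y \<sqinter>\<^bsub>L\<^esub> z) \<sqsubseteq> x"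
      by (rule le_trans[of _ "x \<sqinter>\<^bsub>L\<^esub> z"]) (use assms z in \<open>simp_all add: meet_le1\<close>)
    moreover have "(x \<sqinter>\<^bsub>L\<^esub> z) \<sqinter>\<^bsub>L\<^esub> (y \<sqinter>\<^bsub>L\<^esub> z) \<sqsubseteq> y"
      by (rule le_trans[of _ "y \<sqinter>\<^bsub>L\<^esub> z"]) (use assms z in \<open>simp_all add: meet_le1 meet_le2\<close>)
    ultimately show "(x \<sqinter>\<^bsub>L\<^esub> z) \<sqinter>\<^bsub>L\<^esub> (y \<sqinter>\<^bsub>L\<^esub> z) \<sqsubseteq> s" using R assms z by simp
  qed
qed

text \<open>By \<open>meet_eq_right_iff\<close> the outer meet of the identity encodes an
  inequality, and \<open>le_joins_iff\<close> then absorbs the quantifier over \<open>z\<close> into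
  leastness.\<close>

lemma orth_identity_iff:
  "orth_identity L \<longleftrightarrow>
    (\<forall>u\<in>carrier P. \<forall>y\<in>carrier P. u \<sqsubseteq> \<sim>y \<longrightarrow> is_lub P (u \<squnion>\<^bsub>L\<^esub> y) {u, y})"
proof -
  have "orth_identity L \<longleftrightarrow> (\<forall>x\<in>carrier P. \<forall>y\<in>carrier P.
      is_lub P ((x \<sqinter>\<^bsub>L\<^esub> \<sim>y) \<squnion>\<^bsub>L\<^esub> y) {x \<sqinter>\<^bsub>L\<^esub> \<sim>y, y})"
    unfolding orth_identity_def
    by (simp add: carrier_eq compl_eq pcompl_closed meet_eq_right_iff is_lub_pair_iff
        le_joins_iff join_ge1 join_ge2)
  also have "\<dots> \<longleftrightarrow> (\<forall>u\<in>carrier P. \<forall>y\<in>carrier P. u \<sqsubseteq> \<sim>y \<longrightarrow> is_lub P (u \<squnion>\<^bsub>L\<^esub> y) {u, y})"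
    \<comment> \<open>The elements \<open>x \<sqinter> \<sim>y\<close> are exactly those below
      \<open>\<sim>y\<close>: each lies below it, and any \<open>u\<close> below it equals
      \<open>u \<sqinter> \<sim>y\<close>.\<close>
    by (metis meet_of_le meet_closed meet_le2 pcompl_closed)
  finally show ?thesis .
qed

lemma complemented_poset_iff: "complemented_poset P \<longleftrightarrow> compl_identities L"
proof -
  have one: "\<one> \<in> carrier P" "\<And>x. x \<in> carrier P \<Longrightarrow> x \<sqsubseteq> \<one>"
    using pone_greatest unfolding greatest_def by auto
  have zero: "\<zero> \<in> carrier P" "\<And>x. x \<in> carrier P \<Longrightarrow> \<zero> \<sqsubseteq> x"
    using pzero_least unfolding least_def by auto
  \<comment> \<open>Equations with the extreme elements become inequalities, the form in which
    \<open>le_joins_iff\<close> and \<open>meets_le_iff\<close> can rewrite them.\<close>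
  have eq_one: "x = \<one> \<longleftrightarrow> \<one> \<sqsubseteq> x" if "x \<in> carrier P" for x
    using that one le_antisym by blast
  have eq_zero: "x = \<zero> \<longleftrightarrow> x \<sqsubseteq> \<zero>" if "x \<in> carrier P" for x
    using that zero le_antisym by blast
  have "compl_identities L \<longleftrightarrow>
    (\<forall>x\<in>carrier P. is_lub P \<one> {x, \<sim>x} \<and> is_glb P \<zero> {x, \<sim>x})"
    unfolding compl_identities_def
    by (simp add: carrier_eq compl_eq bot_eq top_eq pcompl_closed eq_one eq_zero ball_conj_distrib
        le_joins_iff meets_le_iff is_lub_pair_iff is_glb_pair_iff one zero)
  moreover have "complemented_poset P \<longleftrightarrow>
    (\<forall>x\<in>carrier P. is_lub P \<one> {x, \<sim>x} \<and> is_glb P \<zero> {x, \<sim>x})"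
    using bounded_unary_poset_axioms
    unfolding complemented_poset_def complemented_poset_axioms_def by blast
  ultimately show ?thesis by simp
qed

end

section \<open>Lambda-lattices assigned to a poset\<close>

lemma assigned_compatible:
  assumes "bounded_unary_poset P" and "assigned_lambda_lattice P L"
  shows "compatible_lambda P L"
proof -
  interpret bounded_unary_poset P by fact
  note A = assms(2)[unfolded assigned_lambda_lattice_def]
  show ?thesis
  proof
    fix x y assume xy: "x \<in> carrier P" "y \<in> carrier P"
    have lub: "is_lub P s {x, y} \<Longrightarrow> x \<squnion>\<^bsub>L\<^esub> y = s" for s using A xy by blast
    have glb: "is_glb P s {x, y} \<Longrightarrow> x \<sqinter>\<^bsub>L\<^esub> y = s" for s using A xy by blast
    \<comment> \<open>Either the supremum exists and is the value, hence a bound by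
      \<open>least_mem\<close>, or the value was chosen among the upper bounds.\<close>
    show "x \<squnion>\<^bsub>L\<^esub> y \<in> Upper P {x, y}" using A xy lub least_mem by metis
    show "x \<sqinter>\<^bsub>L\<^esub> y \<in> Lower P {x, y}" using A xy glb greatest_mem by metis
    \<comment> \<open>Comparable elements have a supremum and an infimum among themselves, so the
      operations are forced on them.\<close>
    show "x \<sqsubseteq>\<^bsub>P\<^esub> y \<Longrightarrow> x \<squnion>\<^bsub>L\<^esub> y = y" using xy by (intro lub) (auto simp: is_lub_pair_iff)
    show "x \<sqsubseteq>\<^bsub>P\<^esub> y \<Longrightarrow> x \<sqinter>\<^bsub>L\<^esub> y = x" using xy by (intro glb) (auto simp: is_glb_pair_iff)
    show "y \<sqsubseteq>\<^bsub>P\<^esub> x \<Longrightarrow> x \<sqinter>\<^bsub>L\<^esub> y = y" using xy by (intro glb) (auto simp: is_glb_pair_iff)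
  qed (use A in auto)
qed

text \<open>Orthogonality asks only that some supremum exist, whereas
  \<open>orth_identity_iff\<close> asks that \<open>\<squnion>\<close> compute it. In an assigned
  lambda-lattice these agree, because \<open>\<squnion>\<close> returns every existing
  supremum.\<close>

theorem assigned_orthogonal_iff:
  assumes "complemented_poset P" and A: "assigned_lambda_lattice P L"
  shows "orthogonal_poset P \<longleftrightarrow> orth_identity L"
proof -
  interpret complemented_poset P by fact
  interpret compatible_lambda P L
    by (rule assigned_compatible[OF bounded_unary_poset_axioms A])
  have "orthogonal_poset P \<longleftrightarrow>
    (\<forall>x\<in>carrier P. \<forall>y\<in>carrier P. x \<sqsubseteq>\<^bsub>P\<^esub> \<sim>\<^bsub>P\<^esub>y \<longrightarrow> (\<exists>s. is_lub P s {x, y}))"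
    using complemented_poset_axioms
    unfolding orthogonal_poset_def orthogonal_poset_axioms_def by blast
  also have "\<dots> \<longleftrightarrow> orth_identity L"
    unfolding orth_identity_iff using A unfolding assigned_lambda_lattice_def by metis
  finally show ?thesis .
qed

section \<open>The order induced by a lambda-lattice\<close>

lemma induced_compatible:
  fixes L (structure)
  assumes "bounded_unary_lambda_lattice L"
  shows "compatible_lambda (induced_poset L) L"
proof -
  interpret bounded_unary_lambda_lattice L by fact
  \<comment> \<open>Absorb twice: \<open>x \<sqinter> (x \<squnion> x)\<close> is \<open>x\<close>,
    and joining \<open>x\<close> with this meet gives \<open>x\<close> again.\<close>
  have idem: "x \<squnion> x = x" if "x \<in> carrier L" for x
    using that by (metis join_absorb meet_absorb join_closed)
  have ge1: "x \<squnion> (x \<squnion> y) = x \<squnion> y" if "x \<in> carrier L" "y \<in> carrier L" for x y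
    using that by (metis join_weak_assoc join_closed idem)
  \<comment> \<open>Under the two premises \<open>(x \<squnion> y) \<squnion> z\<close> collapses to
    \<open>z\<close>, so weak associativity is exactly transitivity.\<close>
  have trans: "x \<squnion> z = z" if "x \<squnion> y = y" "y \<squnion> z = z"
    "x \<in> carrier L" "y \<in> carrier L" "z \<in> carrier L" for x y z
    using that by (metis join_weak_assoc)
  have le_meet: "x \<sqinter> y = x" if "x \<squnion> y = y" "x \<in> carrier L" "y \<in> carrier L" for x y
    using that by (metis meet_absorb)
  have meet_le: "(x \<sqinter> y) \<squnion> x = x" if "x \<in> carrier L" "y \<in> carrier L" for x y
    using that by (metis join_absorb join_comm meet_closed)
  note closed = join_closed meet_closed compl_closed bot_closed top_closed
  show ?thesis
  proof
    show "\<And>x y z. \<lbrakk>x \<in> carrier (induced_poset L); y \<in> carrier (induced_poset L);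
        z \<in> carrier (induced_poset L); x \<sqsubseteq>\<^bsub>induced_poset L\<^esub> y; y \<sqsubseteq>\<^bsub>induced_poset L\<^esub> z\<rbrakk>
      \<Longrightarrow> x \<sqsubseteq>\<^bsub>induced_poset L\<^esub> z"
      by (simp add: induced_poset_def) (metis trans)
    show "\<And>x y. \<lbrakk>x \<sqsubseteq>\<^bsub>induced_poset L\<^esub> y; y \<sqsubseteq>\<^bsub>induced_poset L\<^esub> x; x \<in> carrier (induced_poset L);
        y \<in> carrier (induced_poset L)\<rbrakk> \<Longrightarrow> x .=\<^bsub>induced_poset L\<^esub> y"
      by (simp add: induced_poset_def) (metis join_comm)
    show "\<And>x y. \<lbrakk>x \<in> carrier (induced_poset L); y \<in> carrier (induced_poset L)\<rbrakk>
      \<Longrightarrow> x \<squnion> y \<in> Upper (induced_poset L) {x, y}"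
      by (auto simp: induced_poset_def Upper_def closed ge1) (metis ge1 join_comm)
    show "\<And>x y. \<lbrakk>x \<in> carrier (induced_poset L); y \<in> carrier (induced_poset L)\<rbrakk>
      \<Longrightarrow> x \<sqinter> y \<in> Lower (induced_poset L) {x, y}"
      by (auto simp: induced_poset_def Lower_def closed meet_le) (metis meet_le meet_comm)
    show "least (induced_poset L) \<zero>\<^bsub>induced_poset L\<^esub> (carrier (induced_poset L))"
      by (auto simp: induced_poset_def least_def closed) (metis join_bot join_comm bot_closed)
    show "greatest (induced_poset L) \<one>\<^bsub>induced_poset L\<^esub> (carrier (induced_poset L))"
      by (auto simp: induced_poset_def greatest_def closed join_top)
    show "\<And>x y. \<lbrakk>x \<in> carrier (induced_poset L); y \<in> carrier (induced_poset L);
        y \<sqsubseteq>\<^bsub>induced_poset L\<^esub> x\<rbrakk> \<Longrightarrow> x \<sqinter> y = y"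
      by (simp add: induced_poset_def) (metis le_meet meet_comm)
  qed (auto simp: induced_poset_def closed idem le_meet)
qed

text \<open>Since suprema are unique, existence of the orthogonal joins and agreement of
  \<open>\<squnion>\<close> with them merge into one condition: \<open>x \<squnion> y\<close> is the
  supremum. That is what \<open>orth_identity_iff\<close> characterizes.\<close>

lemma Lo_iff:
  "L \<in> Lo \<longleftrightarrow> bounded_unary_lambda_lattice L \<and> compl_identities L \<and> orth_identity L"
proof (cases "bounded_unary_lambda_lattice L")
  case True
  then interpret bounded_unary_lambda_lattice L .
  interpret compatible_lambda "induced_poset L" L by (rule induced_compatible[OF True])
  let ?P = "induced_poset L"
  have lub_unique: "is_lub ?P s A \<Longrightarrow> is_lub ?P t A \<Longrightarrow> s = t" for s t A
    by (rule least_unique)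
  have "L \<in> Lo \<longleftrightarrow> complemented_poset ?P \<and>
    (\<forall>x\<in>carrier ?P. \<forall>y\<in>carrier ?P. x \<sqsubseteq>\<^bsub>?P\<^esub> \<sim>\<^bsub>?P\<^esub>y \<longrightarrow> (\<exists>s. is_lub ?P s {x, y})) \<and>
    (\<forall>x\<in>carrier ?P. \<forall>y\<in>carrier ?P. \<forall>s.
      x \<sqsubseteq>\<^bsub>?P\<^esub> \<sim>\<^bsub>?P\<^esub>y \<and> is_lub ?P s {x, y} \<longrightarrow> x \<squnion>\<^bsub>L\<^esub> y = s)"
    using True unfolding Lo_def orthogonal_poset_def orthogonal_poset_axioms_def
    by (auto simp: carrier_eq compl_eq)
  also have "\<dots> \<longleftrightarrow> complemented_poset ?P \<and>
    (\<forall>x\<in>carrier ?P. \<forall>y\<in>carrier ?P. x \<sqsubseteq>\<^bsub>?P\<^esub> \<sim>\<^bsub>?P\<^esub>y \<longrightarrow> is_lub ?P (x \<squnion>\<^bsub>L\<^esub> y) {x, y})"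
    using lub_unique by (intro conj_cong refl iffI) blast+
  finally show ?thesis using True by (simp add: complemented_poset_iff orth_identity_iff)
qed (simp add: Lo_def)

section \<open>Equational classes are varieties\<close>

text \<open>With terms as data, preservation of identities is proved once by induction, not
  separately for each identity.\<close>

datatype lterm = Var nat | Join lterm lterm | Meet lterm lterm | Compl lterm | Bot | Top

primrec leval :: "('a, 'm) unary_lambda_scheme \<Rightarrow> (nat \<Rightarrow> 'a) \<Rightarrow> lterm \<Rightarrow> 'a" where
  "leval L v (Var n) = v n"
| "leval L v (Join s t) = leval L v s \<squnion>\<^bsub>L\<^esub> leval L v t"
| "leval L v (Meet s t) = leval L v s \<sqinter>\<^bsub>L\<^esub> leval L v t"
| "leval L v (Compl t) = \<ominus>\<^bsub>L\<^esub>(leval L v t)"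
| "leval L v Bot = \<bottom>\<^sub>\<lambda>\<^bsub>L\<^esub>"
| "leval L v Top = \<top>\<^sub>\<lambda>\<^bsub>L\<^esub>"

text \<open>Record operations are total on the whole type, so closure of the carrier must be
  required; the carrier being a subuniverse of its own algebra says this.\<close>

definition equational_class :: "(lterm \<times> lterm) set \<Rightarrow> 'a unary_lambda set" where
  "equational_class E = {L. subuniverse (carrier L) L \<and>
     (\<forall>(s, t)\<in>E. \<forall>v. range v \<subseteq> carrier L \<longrightarrow> leval L v s = leval L v t)}"

lemma leval_closed:
  "\<lbrakk>subuniverse S L; range v \<subseteq> S\<rbrakk> \<Longrightarrow> leval L v t \<in> S"
  by (induction t) (auto simp: subuniverse_def)

text \<open>A homomorphism respects the operations only on the carrier, so the induction needs the
  values of subterms to stay there.\<close>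

lemma leval_hom:
  assumes "h \<in> lambda_hom A B" "subuniverse (carrier A) A" "range v \<subseteq> carrier A"
  shows "leval B (h \<circ> v) t = h (leval A v t)"
  by (induction t) (use assms leval_closed[OF assms(2,3)] in \<open>auto simp: lambda_hom_def\<close>)

lemma leval_restrict_carrier: "leval (A\<lparr>carrier := S\<rparr>) v t = leval A v t"
  by (induction t) auto

lemma leval_lambda_product:
  "i \<in> I \<Longrightarrow> leval (lambda_product I A) v t i = leval (A i) (\<lambda>n. v n i) t"
  by (induction t) (auto simp: lambda_product_def)

text \<open>An assignment in \<open>B\<close> lifts along the surjection to one in \<open>A\<close>,
  where the equation holds; applying \<open>h\<close> carries it back.\<close>

lemma equational_class_hom_image:
  assumes A: "A \<in> equational_class E" and h: "h \<in> lambda_hom A B"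
    and surj: "h ` carrier A = carrier B"
  shows "B \<in> equational_class E"
proof -
  have subA: "subuniverse (carrier A) A" using A by (simp add: equational_class_def)
  have "subuniverse (h ` carrier A) B"
    using h subA unfolding subuniverse_def lambda_hom_def
    by (auto simp flip: surj) (metis imageI)+
  moreover have "leval B v s = leval B v t"
    if st: "(s, t) \<in> E" and v: "range v \<subseteq> carrier B" for s t v
  proof -
    define w where "w = inv_into (carrier A) h \<circ> v"
    have "v n \<in> h ` carrier A" for n using v surj by auto
    then have w: "range w \<subseteq> carrier A" and "h \<circ> w = v"
      by (auto simp: w_def inv_into_into f_inv_into_f)
    then have "leval B v r = h (leval A w r)" for r
      using leval_hom[OF h subA w] by simp
    moreover have "leval A w s = leval A w t"
      using A st w unfolding equational_class_def by blast
    ultimately show ?thesis by simp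
  qed
  ultimately show ?thesis by (auto simp: equational_class_def surj)
qed

lemma equational_class_subalgebra:
  assumes "A \<in> equational_class E" and "subuniverse S A"
  shows "A\<lparr>carrier := S\<rparr> \<in> equational_class E"
  using assms by (fastforce simp: equational_class_def leval_restrict_carrier subuniverse_def)

lemma equational_class_product:
  assumes A: "\<And>i. i \<in> I \<Longrightarrow> A i \<in> equational_class E"
  shows "lambda_product I A \<in> equational_class E"
proof -
  let ?P = "lambda_product I A"
  have sub: "subuniverse (carrier ?P) ?P"
    using A unfolding equational_class_def subuniverse_def lambda_product_def
    by (auto simp: PiE_iff)
  moreover have "leval ?P v s = leval ?P v t"
    if st: "(s, t) \<in> E" and v: "range v \<subseteq> carrier ?P" for s t v
  \<comment> \<open>Members of the product are \<open>undefined\<close> outside \<open>I\<close>, so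
    comparing coordinates in \<open>I\<close> suffices once both values are known to be
    members.\<close>
  proof (rule PiE_ext)
    show "leval ?P v s \<in> (\<Pi>\<^sub>E i\<in>I. carrier (A i))" "leval ?P v t \<in> (\<Pi>\<^sub>E i\<in>I. carrier (A i))"
      using leval_closed[OF sub v] by (simp_all add: lambda_product_def)
    fix i assume i: "i \<in> I"
    then have "range (\<lambda>n. v n i) \<subseteq> carrier (A i)"
      using v by (auto simp: lambda_product_def)
    then have "leval (A i) (\<lambda>n. v n i) s = leval (A i) (\<lambda>n. v n i) t"
      using A[OF i] st unfolding equational_class_def by blast
    then show "leval ?P v s i = leval ?P v t i" using i by (simp add: leval_lambda_product)
  qed
  ultimately show ?thesis by (auto simp: equational_class_def)
qed

text \<open>The easy direction of Birkhoff's HSP theorem.\<close>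

theorem variety_equational_class:
  "variety (equational_class E) (equational_class E) (equational_class E)"
  unfolding variety_def
  by (intro conjI allI ballI impI)
    (auto intro: equational_class_hom_image equational_class_subalgebra equational_class_product)

section \<open>An equational axiomatization of \<open>Lo\<close>\<close>

definition Lo_equations :: "(lterm \<times> lterm) set" where
  "Lo_equations = (let x = Var 0; y = Var 1; z = Var 2; u = Meet x (Compl y) in
    {(Join x y, Join y x),
     (Meet x y, Meet y x),
     (Join x (Join (Join x y) z), Join (Join x y) z),
     (Meet x (Meet (Meet x y) z), Meet (Meet x y) z),
     (Join x (Meet x y), x),
     (Meet x (Join x y), x),
     (Join x Bot, x),
     (Join x Top, Top),
     (Join (Join x z) (Join (Compl x) z), Top),
     (Meet (Meet x z) (Meet (Compl x) z), Bot),
     (Meet (Join (Join u z) (Join y z)) (Join u y), Join u y)})"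

text \<open>The first eight equations are the bounded lambda-lattice axioms, the next two give
  \<open>compl_identities\<close> and the last gives \<open>orth_identity\<close>, matching
  \<open>Lo_iff\<close>.\<close>

lemma Lo_eq_equational_class: "Lo = equational_class Lo_equations"
proof (intro equalityI subsetI)
  fix L :: "'a unary_lambda"
  assume "L \<in> Lo"
  then have B: "bounded_unary_lambda_lattice L" "compl_identities L" "orth_identity L"
    by (simp_all add: Lo_iff)
  interpret bounded_unary_lambda_lattice L by fact
  have "subuniverse (carrier L) L"
    by (simp add: subuniverse_def join_closed meet_closed compl_closed bot_closed top_closed)
  moreover have "leval L v s = leval L v t"
    if st: "(s, t) \<in> Lo_equations" and v: "range v \<subseteq> carrier L" for s t v
  proof -
    have v: "v n \<in> carrier L" for n using v by auto
    show ?thesis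
      using st B(2,3) v unfolding Lo_equations_def Let_def compl_identities_def orth_identity_def
      \<comment> \<open>The first alternative counts only if it closes the goal. It serves the two
        commutative laws, whose instances could disturb the left-hand sides of the other
        axioms.\<close>
      by (elim insertE emptyE;
          (simp add: join_comm[of "v 0" "v (Suc 0)"] meet_comm[of "v 0" "v (Suc 0)"]; fail
          | simp add: join_weak_assoc meet_weak_assoc join_absorb meet_absorb join_bot join_top))
  qed
  ultimately show "L \<in> equational_class Lo_equations"
    by (auto simp: equational_class_def)
next
  fix L :: "'a unary_lambda"
  assume L: "L \<in> equational_class Lo_equations"
  then have sub: "subuniverse (carrier L) L" by (simp add: equational_class_def)
  \<comment> \<open>The equations use only the variables 0, 1 and 2. Every later index also goes to
    \<open>z\<close>, which keeps the range inside the carrier.\<close>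
  have eqs: "\<forall>(s, t)\<in>Lo_equations.
      leval L (\<lambda>n. if n = 0 then x else if n = 1 then y else z) s =
      leval L (\<lambda>n. if n = 0 then x else if n = 1 then y else z) t"
    if "x \<in> carrier L" "y \<in> carrier L" "z \<in> carrier L" for x y z
    using L that unfolding equational_class_def by (auto simp: image_subset_iff)
  note eqs = eqs[unfolded Lo_equations_def Let_def, simplified]
  have "bounded_unary_lambda_lattice L"
    by unfold_locales (use sub[unfolded subuniverse_def] eqs in meson)+
  moreover have "compl_identities L" "orth_identity L"
    unfolding compl_identities_def orth_identity_def using eqs by meson+
  ultimately show "L \<in> Lo" by (simp add: Lo_iff)
qed

theorem theorem4:
  shows "(\<forall>(P :: 'p unary_poset) L. complemented_poset P \<and> assigned_lambda_lattice P L \<longrightarrow>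
      (orthogonal_poset P \<longleftrightarrow>
        (\<forall>x\<in>carrier L. \<forall>y\<in>carrier L. \<forall>z\<in>carrier L.
          (((x \<sqinter>\<^bsub>L\<^esub> \<ominus>\<^bsub>L\<^esub>y) \<squnion>\<^bsub>L\<^esub> z) \<squnion>\<^bsub>L\<^esub> (y \<squnion>\<^bsub>L\<^esub> z)) \<sqinter>\<^bsub>L\<^esub> ((x \<sqinter>\<^bsub>L\<^esub> \<ominus>\<^bsub>L\<^esub>y) \<squnion>\<^bsub>L\<^esub> y)
            = (x \<sqinter>\<^bsub>L\<^esub> \<ominus>\<^bsub>L\<^esub>y) \<squnion>\<^bsub>L\<^esub> y)))
    \<and> variety (Lo :: 'a unary_lambda set) (Lo :: 'b unary_lambda set)
        (Lo :: ('i \<Rightarrow> 'a) unary_lambda set)"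
  \<comment> \<open>The same \<open>Lo_equations\<close> axiomatizes \<open>Lo\<close> at all three
    types, so the instances of \<open>Lo\<close> become instances of one equational class.\<close>
  using assigned_orthogonal_iff variety_equational_class[of Lo_equations]
  unfolding Lo_eq_equational_class orth_identity_def by blast

end
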